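(* Let $\mathcal H$ be a real Hilbert space and let $\Phi:\mathcal H\to\mathbb R$ be a continuously differentiable convex function with $\operatorname{argmin}\Phi\neq\emptyset$ such that $\nabla\Phi$ is Lipschitz-continuous on bounded sets. Let $t_0>0$, $\alpha>3$, and let $x:[t_0,+\infty[\to\mathcal H$ be a solution of $$\ddot x(t)+\frac{\alpha}{t}\dot x(t)+\nabla\Phi(x(t))=0 .$$ Then $\ddot x$ is bounded and globally Lipschitz continuous on $[t_0,+\infty[$, and satisfies $$\lim_{t\to+\infty}\frac{1}{t^{\alpha}}\int_{t_0}^{t}s^{\alpha}\|\ddot x(s)\|^2\,ds=0 .$$
   Context: A solution on $[t_0,+\infty[$ is a twice continuously differentiable function $x:[t_0,+\infty[\to\mathcal H$ satisfying the equation for all $t\ge t_0$. $\operatorname{argmin}\Phi$ denotes the set of global minimizers of $\Phi$. "$\nabla\Phi$ is Lipschitz-continuous on bounded sets" means that for every bounded set $B\subset\mathcal H$ the restriction of $\nabla\Phi$ to $B$ is Lipschitz continuous. *)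

theory Defs
  imports "HOL-Analysis.Analysis"
begin

definition argmin_set :: "('a \<Rightarrow> real) \<Rightarrow> 'a set" where
  "argmin_set \<Phi> = {z. \<forall>y. \<Phi> z \<le> \<Phi> y}"

definition lipschitz_on_bounded_sets :: "('a::real_normed_vector \<Rightarrow> 'b::real_normed_vector) \<Rightarrow> bool" where
  "lipschitz_on_bounded_sets f \<longleftrightarrow> (\<forall>B. bounded B \<longrightarrow> (\<exists>L. L-lipschitz_on B f))"

text \<open>
  The functions \<open>v\<close> and \<open>a\<close> are the first and second derivatives of \<open>x\<close> on the closed half-line
  (one-sided at the left endpoint \<open>t0\<close>); they are uniquely determined there by \<open>x\<close>.
  The parameter \<open>G\<close> stands for the gradient of the potential.
\<close>
definition solution_with_derivs ::
  "real \<Rightarrow> real \<Rightarrow> ('a::real_normed_vector \<Rightarrow> 'a) \<Rightarrow> (real \<Rightarrow> 'a) \<Rightarrow> (real \<Rightarrow> 'a) \<Rightarrow> (real \<Rightarrow> 'a) \<Rightarrow> bool" where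
  "solution_with_derivs t0 \<alpha> G x v a \<longleftrightarrow>
     (\<forall>t\<ge>t0. (x has_vector_derivative v t) (at t within {t0..})) \<and>
     (\<forall>t\<ge>t0. (v has_vector_derivative a t) (at t within {t0..})) \<and>
     continuous_on {t0..} a \<and>
     (\<forall>t\<ge>t0. a t + (\<alpha> / t) *\<^sub>R v t + G (x t) = 0)"

end

theory Submission
  imports Defs
begin

text \<open>
  Write \<open>v\<close> and \<open>a\<close> for the first two derivatives of \<open>x\<close>. A Lyapunov function shows that \<open>x\<close> is bounded and \<open>norm (v t) \<le> M / t\<close>; boundedness and
  Lipschitz continuity of \<open>a\<close> are then read off the equation. Multiplying the differentiated
  equation by \<open>t powr \<alpha> *\<^sub>R v t\<close> and bounding the rate of change of the gradient along the
  trajectory by \<open>L * norm (v t)\<close> shows that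
  \<open>t powr \<alpha> * (v t \<bullet> a t)\<close> grows at least as fast as the integral of
  \<open>s powr \<alpha> * ((norm (a s))\<^sup>2 - L * (norm (v s))\<^sup>2)\<close>. So the weighted integral of
  \<open>(norm (a s))\<^sup>2\<close> is at most a constant plus terms of order \<open>t powr (\<alpha> - 1)\<close>.
\<close>

section \<open>Convexity and one-sided differential calculus\<close>

text \<open>On the line through \<open>x\<close> and \<open>z\<close> the function restricts to a
  convex function of one real variable, which lies above its tangent at 0; comparing the values at 1
  and 0 gives the claim.\<close>

lemma convex_on_gradient_inequality:
  fixes \<Phi> :: "'a::real_inner \<Rightarrow> real"
  assumes "convex_on UNIV \<Phi>" and "GDERIV \<Phi> x :> g"
  shows "\<Phi> x + g \<bullet> (z - x) \<le> \<Phi> z"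
proof -
  define f where "f = (\<lambda>u::real. \<Phi> (x + u *\<^sub>R (z - x)))"
  have "convex_on UNIV f"
  proof (rule convex_onI)
    fix t u w :: real
    assume "0 < t" "t < 1"
    moreover have "x + ((1 - t) *\<^sub>R u + t *\<^sub>R w) *\<^sub>R (z - x) =
        (1 - t) *\<^sub>R (x + u *\<^sub>R (z - x)) + t *\<^sub>R (x + w *\<^sub>R (z - x))"
      by (simp add: algebra_simps)
    ultimately show "f ((1 - t) *\<^sub>R u + t *\<^sub>R w) \<le> (1 - t) * f u + t * f w"
      unfolding f_def using convex_onD[OF assms(1), of t] by simp
  qed simp
  moreover have "(f has_real_derivative g \<bullet> (z - x)) (at 0)"
  proof -
    have "((\<lambda>u::real. x + u *\<^sub>R (z - x)) has_derivative (\<lambda>h. h *\<^sub>R (z - x))) (at 0)"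
      by (auto intro!: derivative_eq_intros)
    then have "(f has_derivative (\<lambda>h. (h *\<^sub>R (z - x)) \<bullet> g)) (at 0)"
      unfolding f_def
      by (rule has_derivative_compose) (use assms(2) in \<open>simp add: gderiv_def\<close>)
    then show ?thesis
      by (rule has_derivative_imp_has_field_derivative) (simp add: inner_commute)
  qed
  ultimately have "(g \<bullet> (z - x)) * (1 - 0) \<le> f 1 - f 0"
    by (intro convex_on_imp_above_tangent[where A = UNIV]) auto
  then show ?thesis by (simp add: f_def)
qed

lemma DERIV_within_nonpos_imp_decreasing:
  fixes f f' :: "real \<Rightarrow> real"
  assumes "a \<le> b"
    and "\<And>t. \<lbrakk>a \<le> t; t \<le> b\<rbrakk> \<Longrightarrow> (f has_real_derivative f' t) (at t within {a..b})"
    and "\<And>t. \<lbrakk>a \<le> t; t \<le> b\<rbrakk> \<Longrightarrow> f' t \<le> 0"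
  shows "f b \<le> f a"
proof (cases "a = b")
  case False
  then obtain t where "t \<in> {a<..<b}" "f b - f a = f' t * (b - a)"
    using mvt_simple[of a b f "\<lambda>t h. f' t * h"] assms(1,2)
    by (auto simp: has_field_derivative_def)
  then show ?thesis
    using assms(3)[of t] mult_nonpos_nonneg[of "f' t" "b - a"] by auto
qed simp

text \<open>The minorant \<open>r\<close> with limit \<open>D\<close> expresses a nonnegative lower
  right Dini derivative without a liminf. After tilting by a small slope \<open>c\<close>, the set
  \<open>S\<close> of points where \<open>Q\<close> is at least \<open>Q a\<close> is compact. Its
  largest element must be \<open>b\<close>, since to the right of any earlier element there are
  points where \<open>Q\<close> is larger still.\<close>

lemma right_Dini_nonneg_imp_le:
  fixes f :: "real \<Rightarrow> real"
  assumes "a \<le> b" and cont: "continuous_on {a..b} f"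
    and Dini: "\<And>s. \<lbrakk>a \<le> s; s < b\<rbrakk> \<Longrightarrow> \<exists>r D. (r \<longlongrightarrow> D) (at_right s) \<and> 0 \<le> D \<and>
      (\<forall>\<^sub>F y in at_right s. r y \<le> (f y - f s) / (y - s))"
  shows "f a \<le> f b"
proof (rule field_le_epsilon)
  fix e :: real assume "e > 0"
  \<comment> \<open>The summand 1 keeps \<open>c\<close> positive when \<open>a = b\<close>; the
    total tilt \<open>c * (b - a)\<close> stays below \<open>e\<close>.\<close>
  define c where "c = e / (b - a + 1)"
  have c: "c > 0" "c * (b - a) \<le> e"
    using \<open>e > 0\<close> \<open>a \<le> b\<close> by (auto simp: c_def field_simps)
  define Q where "Q = (\<lambda>s. f s + c * (s - a))"
  define S where "S = {a..b} \<inter> Q -` {Q a..}"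
  have "continuous_on {a..b} Q"
    unfolding Q_def by (intro continuous_intros cont)
  then have "closed S"
    unfolding S_def by (rule continuous_closed_preimage) auto
  moreover have "bounded S"
    unfolding S_def by (rule bounded_subset[of "{a..b}"]) auto
  moreover have "a \<in> S"
    using \<open>a \<le> b\<close> by (auto simp: S_def)
  ultimately obtain s where s: "s \<in> S" and max: "\<And>y. y \<in> S \<Longrightarrow> y \<le> s"
    using compact_attains_sup[of S] by (auto simp: compact_eq_bounded_closed)
  have "s = b"
  proof (rule ccontr)
    assume "s \<noteq> b"
    then have sb: "a \<le> s" "s < b" using s by (auto simp: S_def)
    then obtain r D where r: "(r \<longlongrightarrow> D) (at_right s)" "0 \<le> D"
      "\<forall>\<^sub>F y in at_right s. r y \<le> (f y - f s) / (y - s)"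
      using Dini by blast
    have "\<forall>\<^sub>F y in at_right s. - c < r y"
      using r(1,2) c(1) by (intro order_tendstoD(1)[OF r(1)]) auto
    moreover have "\<forall>\<^sub>F y in at_right s. y \<in> {s<..<b}"
      using sb(2) by (rule eventually_at_right_real)
    ultimately have "\<forall>\<^sub>F y in at_right s. y \<in> {s<..<b} \<and> - c < (f y - f s) / (y - s)"
      using r(3) by eventually_elim auto
    then obtain y where y: "s < y" "y < b" "- c < (f y - f s) / (y - s)"
      using eventually_happens[of _ "at_right s"] by (auto simp: trivial_limit_at_right_real)
    then have "Q s \<le> Q y" by (simp add: Q_def field_simps)
    then have "y \<in> S" using s sb y by (auto simp: S_def)
    then show False using max[of y] y by simp
  qed
  then show "f a \<le> f b + e" using s c by (auto simp: S_def Q_def)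
qed

lemma has_real_derivative_inner:
  fixes p q :: "real \<Rightarrow> 'a::real_inner"
  assumes "(p has_vector_derivative p') (at t within S)"
    and "(q has_vector_derivative q') (at t within S)"
  shows "((\<lambda>t. p t \<bullet> q t) has_real_derivative (p t \<bullet> q' + p' \<bullet> q t)) (at t within S)"
  using has_derivative_inner[OF assms[unfolded has_vector_derivative_def]]
  by (rule has_derivative_imp_has_field_derivative) (simp add: algebra_simps)

lemma has_vector_derivative_at_right_tendsto:
  assumes "(f has_vector_derivative D) (at_right s)"
  shows "((\<lambda>y. (f y - f s) /\<^sub>R (y - s)) \<longlongrightarrow> D) (at_right s)"
proof (rule LIM_zero_cancel)
  have "((\<lambda>y. (f y - f s - (y - s) *\<^sub>R D) /\<^sub>R norm (y - s)) \<longlongrightarrow> 0) (at_right s)"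
    using assms by (simp add: has_vector_derivative_def has_derivative_at_within)
  moreover have "\<forall>\<^sub>F y in at_right s.
      (f y - f s - (y - s) *\<^sub>R D) /\<^sub>R norm (y - s) = (f y - f s) /\<^sub>R (y - s) - D"
    using eventually_at_right_less[of s] by eventually_elim (simp add: scaleR_diff_right)
  ultimately show "((\<lambda>y. (f y - f s) /\<^sub>R (y - s) - D) \<longlongrightarrow> 0) (at_right s)"
    by (rule Lim_transform_eventually)
qed

lemma bounded_vector_derivative_imp_lipschitz:
  fixes f :: "real \<Rightarrow> 'a::real_normed_vector"
  assumes "convex S" and "C \<ge> 0"
    and deriv: "\<And>t. t \<in> S \<Longrightarrow> (f has_vector_derivative f' t) (at t within S)"
    and bound: "\<And>t. t \<in> S \<Longrightarrow> norm (f' t) \<le> C"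
  shows "C-lipschitz_on S f"
proof (rule bounded_derivative_imp_lipschitz[OF deriv[unfolded has_vector_derivative_def]])
  fix t assume "t \<in> S"
  then show "onorm (\<lambda>h. h *\<^sub>R f' t) \<le> C"
    using bound by (intro onorm_le) (simp add: mult.commute[of C] mult_left_mono)
qed (use assms in auto)

section \<open>Lyapunov energy and bounds on position and velocity\<close>

locale vanishing_damping =
  fixes \<Phi> :: "'a::{real_inner, banach} \<Rightarrow> real"
    and g :: "'a \<Rightarrow> 'a"
    and t0 \<alpha> :: real
    and x v a :: "real \<Rightarrow> 'a"
  assumes gradient: "\<And>z. GDERIV \<Phi> z :> g z"
    and t0_pos: "t0 > 0"
    and solution: "solution_with_derivs t0 \<alpha> g x v a"
begin

lemma x_deriv: "t \<ge> t0 \<Longrightarrow> (x has_vector_derivative v t) (at t within {t0..})"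
  and v_deriv: "t \<ge> t0 \<Longrightarrow> (v has_vector_derivative a t) (at t within {t0..})"
  and a_cont: "continuous_on {t0..} a"
  using solution by (auto simp: solution_with_derivs_def)

lemma a_eq: "t \<ge> t0 \<Longrightarrow> a t = - (\<alpha> / t) *\<^sub>R v t - g (x t)"
  using solution by (auto simp: solution_with_derivs_def eq_neg_iff_add_eq_0 algebra_simps)

lemma g_eq: "t \<ge> t0 \<Longrightarrow> g (x t) = - a t - (\<alpha> / t) *\<^sub>R v t"
  using a_eq by simp

lemma v_cont: "continuous_on {t0..} v"
  using v_deriv by (auto simp: continuous_on_eq_continuous_within intro: has_vector_derivative_continuous)

text \<open>The Lyapunov function of Su, Boyd and Candes in the form that also controls \<open>x - z\<close>.\<close>

definition energy :: "'a \<Rightarrow> real \<Rightarrow> real" where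
  "energy z t = t\<^sup>2 * (\<Phi> (x t) - \<Phi> z) +
     ((2 *\<^sub>R (x t - z) + t *\<^sub>R v t) \<bullet> (2 *\<^sub>R (x t - z) + t *\<^sub>R v t)) / 2 +
     (\<alpha> - 3) * ((x t - z) \<bullet> (x t - z))"

lemma \<Phi>_deriv:
  assumes "t \<ge> t0"
  shows "((\<lambda>t. \<Phi> (x t)) has_real_derivative (g (x t) \<bullet> v t)) (at t within {t0..})"
proof -
  have "((\<lambda>t. \<Phi> (x t)) has_derivative (\<lambda>h. (h *\<^sub>R v t) \<bullet> g (x t))) (at t within {t0..})"
    using x_deriv[OF assms] gradient[of "x t"]
    unfolding has_vector_derivative_def gderiv_def
    by (rule has_derivative_compose)
  then show ?thesis
    by (rule has_derivative_imp_has_field_derivative) (simp add: inner_commute)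
qed

text \<open>By the equation, the vector \<open>p\<close> has derivative
  \<open>(3 - \<alpha>) *\<^sub>R v t - t *\<^sub>R g (x t)\<close>. In \<open>p t\<close> times
  this, the product of \<open>v\<close> and \<open>g\<close> cancels against the derivative of the
  potential, and the product of \<open>x - z\<close> and \<open>v\<close> cancels against the last
  energy term; the weight \<open>\<alpha> - 3\<close> is chosen for this.\<close>

lemma energy_deriv:
  assumes "t \<ge> t0"
  shows "(energy z has_real_derivative
    t * (2 * (\<Phi> (x t) - \<Phi> z) + 2 * (g (x t) \<bullet> (z - x t))) - (\<alpha> - 3) * t * (v t \<bullet> v t))
    (at t within {t0..})"
proof -
  have t: "t > 0" using assms t0_pos by simp
  define p where "p = (\<lambda>t. 2 *\<^sub>R (x t - z) + t *\<^sub>R v t)"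
  have p: "(p has_vector_derivative (3 *\<^sub>R v t + t *\<^sub>R a t)) (at t within {t0..})"
    unfolding p_def using x_deriv[OF assms] v_deriv[OF assms]
    by (auto intro!: derivative_eq_intros simp: scaleR_left_distrib[of 1 2, simplified])
  have xz: "((\<lambda>t. x t - z) has_vector_derivative v t) (at t within {t0..})"
    using x_deriv[OF assms] by (auto intro!: derivative_eq_intros)
  have "energy z = (\<lambda>t. t\<^sup>2 * (\<Phi> (x t) - \<Phi> z) + (p t \<bullet> p t) / 2 + (\<alpha> - 3) * ((x t - z) \<bullet> (x t - z)))"
    by (simp add: fun_eq_iff energy_def p_def)
  moreover have "(\<dots> has_real_derivative
      2 * t * (\<Phi> (x t) - \<Phi> z) + t\<^sup>2 * (g (x t) \<bullet> v t) + p t \<bullet> (3 *\<^sub>R v t + t *\<^sub>R a t)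
      + (\<alpha> - 3) * (2 * ((x t - z) \<bullet> v t))) (at t within {t0..})"
    by (rule derivative_eq_intros \<Phi>_deriv[OF assms] has_real_derivative_inner[OF p p]
        has_real_derivative_inner[OF xz xz] refl | simp add: inner_commute algebra_simps)+
  moreover have accel: "3 *\<^sub>R v t + t *\<^sub>R a t = (3 - \<alpha>) *\<^sub>R v t - t *\<^sub>R g (x t)"
    unfolding a_eq[OF assms] using t by (simp add: algebra_simps)
  have "2 * t * (\<Phi> (x t) - \<Phi> z) + t\<^sup>2 * (g (x t) \<bullet> v t) + p t \<bullet> (3 *\<^sub>R v t + t *\<^sub>R a t)
      + (\<alpha> - 3) * (2 * ((x t - z) \<bullet> v t)) =
      t * (2 * (\<Phi> (x t) - \<Phi> z) + 2 * (g (x t) \<bullet> (z - x t))) - (\<alpha> - 3) * t * (v t \<bullet> v t)"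
    unfolding accel
    by (simp add: p_def inner_add_left inner_diff_left inner_diff_right inner_commute
        power2_eq_square algebra_simps)
  ultimately show ?thesis by simp
qed

lemma energy_decreasing:
  assumes "convex_on UNIV \<Phi>" and "\<alpha> \<ge> 3" and "t \<ge> t0"
  shows "energy z t \<le> energy z t0"
proof (rule DERIV_within_nonpos_imp_decreasing[OF \<open>t \<ge> t0\<close>])
  fix s assume s: "t0 \<le> s" "s \<le> t"
  show "(energy z has_real_derivative
    s * (2 * (\<Phi> (x s) - \<Phi> z) + 2 * (g (x s) \<bullet> (z - x s))) - (\<alpha> - 3) * s * (v s \<bullet> v s))
    (at s within {t0..t})"
    using energy_deriv[OF s(1)] by (rule has_field_derivative_subset) auto
  have "2 * (\<Phi> (x s) - \<Phi> z) + 2 * (g (x s) \<bullet> (z - x s)) \<le> 0"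
    using convex_on_gradient_inequality[OF assms(1) gradient, of "x s" z] by simp
  then have "s * (2 * (\<Phi> (x s) - \<Phi> z) + 2 * (g (x s) \<bullet> (z - x s))) \<le> 0"
    using s t0_pos by (intro mult_nonneg_nonpos) auto
  moreover have "0 \<le> (\<alpha> - 3) * s * (v s \<bullet> v s)"
    using s t0_pos assms(2) by simp
  ultimately show "s * (2 * (\<Phi> (x s) - \<Phi> z) + 2 * (g (x s) \<bullet> (z - x s))) -
      (\<alpha> - 3) * s * (v s \<bullet> v s) \<le> 0" by simp
qed

text \<open>For a minimizer \<open>z\<close> all three energy terms are nonnegative, so each is at
  most the initial energy. Strictness of \<open>\<alpha> > 3\<close> makes the third one control
  \<open>x - z\<close>; the second then controls \<open>t *\<^sub>R v t\<close>.\<close>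

lemma bounded_trajectory:
  assumes "convex_on UNIV \<Phi>" and "\<alpha> > 3" and z: "\<And>y. \<Phi> z \<le> \<Phi> y"
  obtains M where "\<And>t. t \<ge> t0 \<Longrightarrow> norm (x t - z) \<le> M" "\<And>t. t \<ge> t0 \<Longrightarrow> norm (v t) \<le> M / t"
proof -
  define E where "E = energy z t0"
  define R where "R = sqrt (E / (\<alpha> - 3))"
  \<comment> \<open>The bound on \<open>t *\<^sub>R v t\<close>, obtained by subtracting
    \<open>2 *\<^sub>R (x t - z)\<close> from the vector in the energy. It also dominates
    \<open>R\<close>, so one constant serves both conclusions.\<close>
  define M where "M = sqrt (2 * E) + 2 * R"
  have bounds: "norm (x t - z) \<le> R" "norm (2 *\<^sub>R (x t - z) + t *\<^sub>R v t) \<le> sqrt (2 * E)"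
    if t: "t \<ge> t0" for t
  proof -
    have 1: "energy z t \<le> E"
      unfolding E_def using energy_decreasing assms t by simp
    have 2: "0 \<le> t\<^sup>2 * (\<Phi> (x t) - \<Phi> z)" using z[of "x t"] by simp
    have 3: "0 \<le> (\<alpha> - 3) * (norm (x t - z))\<^sup>2" using assms(2) by simp
    have 4: "energy z t = t\<^sup>2 * (\<Phi> (x t) - \<Phi> z) + (norm (2 *\<^sub>R (x t - z) + t *\<^sub>R v t))\<^sup>2 / 2 +
      (\<alpha> - 3) * (norm (x t - z))\<^sup>2"
      by (simp add: energy_def power2_norm_eq_inner)
    have "(\<alpha> - 3) * (norm (x t - z))\<^sup>2 \<le> E"
      using 1 2 4 zero_le_power2[of "norm (2 *\<^sub>R (x t - z) + t *\<^sub>R v t)"] by linarith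
    then have "(norm (x t - z))\<^sup>2 \<le> E / (\<alpha> - 3)"
      using assms(2) by (simp add: field_simps)
    then show "norm (x t - z) \<le> R" unfolding R_def by (rule real_le_rsqrt)
    have "(norm (2 *\<^sub>R (x t - z) + t *\<^sub>R v t))\<^sup>2 \<le> 2 * E"
      using 1 2 3 4 by linarith
    then show "norm (2 *\<^sub>R (x t - z) + t *\<^sub>R v t) \<le> sqrt (2 * E)" by (rule real_le_rsqrt)
  qed
  \<comment> \<open>\<open>sqrt\<close> is negative on negative reals, so both signs are read off
    the norm bounds at \<open>t0\<close>.\<close>
  have "0 \<le> R" using bounds(1)[of t0] norm_ge_zero[of "x t0 - z"] by linarith
  moreover have "0 \<le> sqrt (2 * E)"
    using bounds(2)[of t0] norm_ge_zero[of "2 *\<^sub>R (x t0 - z) + t0 *\<^sub>R v t0"] by linarith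
  ultimately have RM: "R \<le> M" by (simp add: M_def)
  show thesis
  proof (rule that)
    fix t assume t: "t \<ge> t0"
    show "norm (x t - z) \<le> M" using bounds(1)[OF t] RM by simp
    have "norm (t *\<^sub>R v t) \<le> norm (2 *\<^sub>R (x t - z) + t *\<^sub>R v t) + norm (2 *\<^sub>R (x t - z))"
      using norm_triangle_ineq4[of "2 *\<^sub>R (x t - z) + t *\<^sub>R v t" "2 *\<^sub>R (x t - z)"] by simp
    also have "\<dots> \<le> M" using bounds[OF t] by (simp add: M_def)
    finally show "norm (v t) \<le> M / t" using t t0_pos by (simp add: field_simps)
  qed
qed

section \<open>Weighted integral of the squared acceleration\<close>

text \<open>
  Where \<open>g \<circ> x\<close> is differentiable, the derivative of \<open>s powr \<alpha> * (v s \<bullet> a s)\<close> is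
  \<open>s powr \<alpha> * (norm (a s))\<^sup>2 + \<alpha> * s powr (\<alpha> - 2) * (norm (v s))\<^sup>2\<close> minus
  \<open>s powr \<alpha>\<close> times the inner product of \<open>v s\<close> with the derivative of \<open>g \<circ> x\<close>.
  As \<open>g \<circ> x\<close> is merely Lipschitz, only a lower right Dini derivative is estimated.
\<close>

lemma integral_acceleration_le:
  assumes L: "L-lipschitz_on (x ` {t0..}) g" and "\<alpha> \<ge> 0" and T: "T \<ge> t0"
  shows "integral {t0..T} (\<lambda>s. s powr \<alpha> * (norm (a s))\<^sup>2) \<le>
    T powr \<alpha> * (v T \<bullet> a T) - t0 powr \<alpha> * (v t0 \<bullet> a t0) +
    L * integral {t0..T} (\<lambda>s. s powr \<alpha> * (norm (v s))\<^sup>2)"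
proof -
  define k where "k = (\<lambda>s. s powr \<alpha> * (norm (a s))\<^sup>2 - L * (s powr \<alpha> * (norm (v s))\<^sup>2))"
  define K where "K = (\<lambda>t. integral {t0..t} k)"
  \<comment> \<open>\<open>P t0 \<le> P T\<close> is the claim rearranged, so it suffices to bound a
    Dini derivative of \<open>P\<close> from below.\<close>
  define P where "P = (\<lambda>t. t powr \<alpha> * (v t \<bullet> a t) - K t)"
  have cont: "continuous_on {t0..T} v" "continuous_on {t0..T} a"
    using v_cont a_cont by (auto intro: continuous_on_subset)
  have cont_powr: "continuous_on {t0..T} (\<lambda>s. s powr \<alpha>)"
    using t0_pos by (auto intro!: continuous_intros)
  have int: "(\<lambda>s. s powr \<alpha> * (norm (a s))\<^sup>2) integrable_on {t0..T}"
      "(\<lambda>s. s powr \<alpha> * (norm (v s))\<^sup>2) integrable_on {t0..T}"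
    by (intro integrable_continuous_real continuous_intros cont cont_powr)+
  have k_cont: "continuous_on {t0..T} k"
    unfolding k_def by (intro continuous_intros cont cont_powr)
  have K_deriv: "(K has_real_derivative k s) (at s within {t0..T})" if "s \<in> {t0..T}" for s
    unfolding K_def using integral_has_real_derivative[OF k_cont that] .
  have K_cont: "continuous_on {t0..T} K"
    unfolding continuous_on_eq_continuous_within using K_deriv DERIV_continuous by blast
  have "P t0 \<le> P T"
  proof (rule right_Dini_nonneg_imp_le[OF T])
    show "continuous_on {t0..T} P"
      unfolding P_def by (intro continuous_intros cont cont_powr K_cont)
    fix s assume s: "t0 \<le> s" "s < T"
    have s0: "s > 0" using s t0_pos by simp
    have sub: "at_right s \<le> at s within {t0..}" using s by (intro at_le) auto
    have right: "(f has_vector_derivative D) (at_right s)"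
      if "(f has_vector_derivative D) (at s within {t0..})" for f :: "real \<Rightarrow> 'a" and D
      using that s by (auto intro: has_vector_derivative_within_subset)
    note xd = right[OF x_deriv[OF s(1)]] and vd = right[OF v_deriv[OF s(1)]]
    have ev: "\<forall>\<^sub>F y in at_right s. y \<in> {s<..<T}"
      using s(2) by (rule eventually_at_right_real)
    have Kd: "(K has_real_derivative k s) (at_right s)"
    proof -
      have "(K has_real_derivative k s) (at s within {s..T})"
        using K_deriv[of s] s by (auto intro: has_field_derivative_subset)
      moreover have "at s within {s..T} = at_right s"
        using s(2) by (simp add: at_within_Icc_at_right)
      ultimately show ?thesis by simp
    qed
    \<comment> \<open>The equation turns \<open>y powr \<alpha> * (v y \<bullet> a y)\<close> into
      an expression in \<open>v y\<close> and \<open>g (x y)\<close>. Freezing the gradient at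
      \<open>x s\<close> makes it differentiable: \<open>Q s = P s\<close>, and
      \<open>P y - Q y\<close> is
      \<open>- (y powr \<alpha>) * (v y \<bullet> (g (x y) - g (x s)))\<close>.\<close>
    define Q where "Q = (\<lambda>y. - \<alpha> * y powr (\<alpha> - 1) * (v y \<bullet> v y)
      - y powr \<alpha> * (v y \<bullet> g (x s)) - K y)"
    \<comment> \<open>The derivative of \<open>Q\<close> at \<open>s\<close> once
      \<open>g (x s)\<close> is eliminated by the equation: the products of \<open>v\<close> and
      \<open>a\<close> cancel, and the squared acceleration cancels against
      \<open>k s\<close>.\<close>
    define Q' where "Q' = \<alpha> * s powr (\<alpha> - 2) * (norm (v s))\<^sup>2 + L * (s powr \<alpha> * (norm (v s))\<^sup>2)"
    define r where "r = (\<lambda>y. (Q y - Q s) / (y - s)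
      - L * (y powr \<alpha> * norm (v y)) * norm ((x y - x s) /\<^sub>R (y - s)))"
    have Qd: "(Q has_real_derivative Q') (at_right s)"
    proof -
      have pw: "((\<lambda>y. y powr b) has_real_derivative b * s powr (b - 1)) (at_right s)" for b
        using has_real_derivative_powr[OF s0] by (rule has_field_derivative_at_within)
      have gd: "((\<lambda>y. v y \<bullet> g (x s)) has_real_derivative (a s \<bullet> g (x s))) (at_right s)"
        using has_real_derivative_inner[OF vd has_vector_derivative_const[of "g (x s)"]] by simp
      have "(Q has_real_derivative
        (- \<alpha> * s powr (\<alpha> - 1) * (2 * (v s \<bullet> a s)) - \<alpha> * (\<alpha> - 1) * s powr (\<alpha> - 2) * (v s \<bullet> v s)
        - (s powr \<alpha> * (a s \<bullet> g (x s)) + \<alpha> * s powr (\<alpha> - 1) * (v s \<bullet> g (x s))) - k s)) (at_right s)"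
        unfolding Q_def
        by (rule derivative_eq_intros pw gd has_real_derivative_inner[OF vd vd] Kd refl)+
          (simp add: inner_commute algebra_simps)
      moreover have "s powr \<alpha> = s\<^sup>2 * s powr (\<alpha> - 2)" "s powr (\<alpha> - 1) = s * s powr (\<alpha> - 2)"
        using s0 by (simp_all add: powr_diff power2_eq_square powr_numeral)
      ultimately show ?thesis
        using s0 unfolding Q'_def k_def g_eq[OF s(1)] power2_norm_eq_inner
        by (simp add: field_simps inner_commute power2_eq_square inner_diff_right)
    qed
    have "(r \<longlongrightarrow> Q' - L * (s powr \<alpha> * norm (v s)) * norm (v s)) (at_right s)"
    proof -
      have "((\<lambda>y. (Q y - Q s) / (y - s)) \<longlongrightarrow> Q') (at_right s)"
        using Qd by (simp add: has_field_derivative_iff)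
      moreover have "(v \<longlongrightarrow> v s) (at_right s)"
        using has_vector_derivative_continuous[OF vd] by (simp add: continuous_within)
      moreover have "((\<lambda>y. (x y - x s) /\<^sub>R (y - s)) \<longlongrightarrow> v s) (at_right s)"
        using xd by (rule has_vector_derivative_at_right_tendsto)
      moreover have "((\<lambda>y. y powr \<alpha>) \<longlongrightarrow> s powr \<alpha>) (at_right s)"
        using s0 by (auto intro!: tendsto_intros)
      ultimately show ?thesis
        unfolding r_def by (intro tendsto_diff tendsto_mult tendsto_const tendsto_norm)
    qed
    moreover have "0 \<le> Q' - L * (s powr \<alpha> * norm (v s)) * norm (v s)"
      unfolding Q'_def using \<open>\<alpha> \<ge> 0\<close> by (simp add: power2_eq_square)
    moreover have "\<forall>\<^sub>F y in at_right s. r y \<le> (P y - P s) / (y - s)"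
      using ev
    proof eventually_elim
      case (elim y)
      then have y: "s < y" "t0 \<le> y" "y > 0" using s s0 by auto
      have P_eq: "P u = - \<alpha> * u powr (\<alpha> - 1) * (v u \<bullet> v u) - u powr \<alpha> * (v u \<bullet> g (x u)) - K u"
        if "t0 \<le> u" for u
        using that t0_pos by (simp add: P_def a_eq[OF that] powr_diff inner_diff_right algebra_simps)
      have "v y \<bullet> (g (x y) - g (x s)) \<le> norm (v y) * (L * norm (x y - x s))"
      proof -
        have "norm (g (x y) - g (x s)) \<le> L * norm (x y - x s)"
          using lipschitz_onD[OF L, of "x y" "x s"] y s by (simp add: dist_norm)
        then show ?thesis
          using norm_cauchy_schwarz[of "v y" "g (x y) - g (x s)"]
            mult_left_mono[of _ _ "norm (v y)"] by (meson norm_ge_zero order_trans)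
      qed
      then have "y powr \<alpha> * (v y \<bullet> (g (x y) - g (x s))) \<le>
          y powr \<alpha> * (norm (v y) * (L * norm (x y - x s)))"
        by (rule mult_left_mono) simp
      then have "Q y - Q s - L * (y powr \<alpha> * norm (v y)) * norm (x y - x s) \<le> P y - P s"
        unfolding P_eq[OF s(1)] P_eq[OF y(2)] Q_def
        by (simp add: inner_diff_right algebra_simps)
      then have "(Q y - Q s - L * (y powr \<alpha> * norm (v y)) * norm (x y - x s)) / (y - s) \<le>
          (P y - P s) / (y - s)"
        using y by (intro divide_right_mono) auto
      moreover have "norm ((x y - x s) /\<^sub>R (y - s)) = norm (x y - x s) / (y - s)"
        using y by (simp add: divide_inverse)
      ultimately show ?case unfolding r_def by (simp add: diff_divide_distrib)
    qed
    ultimately show "\<exists>r D. (r \<longlongrightarrow> D) (at_right s) \<and> 0 \<le> D \<and>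
        (\<forall>\<^sub>F y in at_right s. r y \<le> (P y - P s) / (y - s))"
      by blast
  qed
  moreover have "K T = integral {t0..T} (\<lambda>s. s powr \<alpha> * (norm (a s))\<^sup>2) -
      L * integral {t0..T} (\<lambda>s. s powr \<alpha> * (norm (v s))\<^sup>2)"
    unfolding K_def k_def using int by (simp add: integral_diff integrable_on_mult_right)
  ultimately show ?thesis by (simp add: P_def K_def)
qed

text \<open>In the preceding estimate the boundary term at \<open>t\<close> and the velocity
  integral are both at most a constant times \<open>t powr \<alpha> / t\<close>, and the boundary
  term at \<open>t0\<close> is constant. Division by \<open>t powr \<alpha>\<close> sends all three
  to 0.\<close>

lemma weighted_acceleration_tendsto_0:
  assumes L: "L-lipschitz_on (x ` {t0..}) g" and "\<alpha> \<ge> 2"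
    and M: "\<And>t. t \<ge> t0 \<Longrightarrow> norm (v t) \<le> M / t" and A: "\<And>t. t \<ge> t0 \<Longrightarrow> norm (a t) \<le> A"
  shows "((\<lambda>t. 1 / t powr \<alpha> * integral {t0..t} (\<lambda>s. s powr \<alpha> * (norm (a s))\<^sup>2)) \<longlongrightarrow> 0) at_top"
proof (rule tendsto_sandwich[of "\<lambda>_. 0"])
  define c where "c = t0 powr \<alpha> * (v t0 \<bullet> a t0)"
  have "L \<ge> 0" using L by (rule lipschitz_on_nonneg)
  show "((\<lambda>t. (M * A + L * M\<^sup>2) * inverse t - c * t powr (- \<alpha>)) \<longlongrightarrow> 0) at_top"
  proof -
    have "((\<lambda>t. t powr (- \<alpha>)) \<longlongrightarrow> 0) at_top"
      using \<open>\<alpha> \<ge> 2\<close> by (intro tendsto_neg_powr filterlim_ident) auto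
    moreover have "(inverse \<longlongrightarrow> (0::real)) at_top"
      by (rule tendsto_inverse_0_at_top) (rule filterlim_ident)
    ultimately have "((\<lambda>t. (M * A + L * M\<^sup>2) * inverse t - c * t powr (- \<alpha>))
        \<longlongrightarrow> (M * A + L * M\<^sup>2) * 0 - c * 0) at_top"
      by (intro tendsto_intros)
    then show ?thesis by simp
  qed
  show "\<forall>\<^sub>F t in at_top. 1 / t powr \<alpha> * integral {t0..t} (\<lambda>s. s powr \<alpha> * (norm (a s))\<^sup>2) \<le>
      (M * A + L * M\<^sup>2) * inverse t - c * t powr (- \<alpha>)"
    using eventually_ge_at_top[of t0]
  proof eventually_elim
    case (elim t)
    then have t: "t > 0" using t0_pos by simp
    \<comment> \<open>The decay of \<open>v\<close> bounds the integrand by a multiple of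
      \<open>s powr (\<alpha> - 2)\<close>. This is nondecreasing for
      \<open>\<alpha> \<ge> 2\<close>, so its value at \<open>t\<close> may replace it.\<close>
    have "integral {t0..t} (\<lambda>s. s powr \<alpha> * (norm (v s))\<^sup>2) \<le> integral {t0..t} (\<lambda>s. M\<^sup>2 * t powr (\<alpha> - 2))"
    proof (rule integral_le)
      show "(\<lambda>s. s powr \<alpha> * (norm (v s))\<^sup>2) integrable_on {t0..t}"
        using t0_pos by (intro integrable_continuous_real continuous_intros continuous_on_subset[OF v_cont]) auto
      fix s assume s: "s \<in> {t0..t}"
      then have s0: "s > 0" using t0_pos by simp
      have "(norm (v s))\<^sup>2 \<le> (M / s)\<^sup>2"
        using M[of s] s by (intro power_mono) auto
      then have "s powr \<alpha> * (norm (v s))\<^sup>2 \<le> s powr \<alpha> * (M / s)\<^sup>2"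
        by (rule mult_left_mono) simp
      also have "\<dots> = M\<^sup>2 * s powr (\<alpha> - 2)"
        using s0 by (simp add: powr_diff powr_numeral power_divide)
      also have "\<dots> \<le> M\<^sup>2 * t powr (\<alpha> - 2)"
        using s s0 \<open>\<alpha> \<ge> 2\<close> by (intro mult_left_mono powr_mono2) auto
      finally show "s powr \<alpha> * (norm (v s))\<^sup>2 \<le> M\<^sup>2 * t powr (\<alpha> - 2)" .
    qed (rule integrable_const_ivl)
    also have "\<dots> = (t - t0) * (M\<^sup>2 * t powr (\<alpha> - 2))"
      using elim by simp
    also have "\<dots> \<le> t * (M\<^sup>2 * t powr (\<alpha> - 2))"
      using t0_pos by (intro mult_right_mono) auto
    also have "\<dots> = M\<^sup>2 * t powr \<alpha> / t"
      using t by (simp add: powr_diff powr_numeral power2_eq_square)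
    finally have V: "L * integral {t0..t} (\<lambda>s. s powr \<alpha> * (norm (v s))\<^sup>2) \<le> L * (M\<^sup>2 * t powr \<alpha> / t)"
      using \<open>L \<ge> 0\<close> by (rule mult_left_mono)
    have "v t \<bullet> a t \<le> norm (v t) * norm (a t)" by (rule norm_cauchy_schwarz)
    also have "\<dots> \<le> M / t * A"
      using M[OF elim] A[OF elim] by (intro mult_mono') auto
    finally have "t powr \<alpha> * (v t \<bullet> a t) \<le> t powr \<alpha> * (M / t * A)"
      by (rule mult_left_mono) simp
    then have "integral {t0..t} (\<lambda>s. s powr \<alpha> * (norm (a s))\<^sup>2) \<le>
        t powr \<alpha> * (M / t * A) - c + L * (M\<^sup>2 * t powr \<alpha> / t)"
      using integral_acceleration_le[OF L _ elim] V \<open>\<alpha> \<ge> 2\<close> by (simp add: c_def)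
    then have "1 / t powr \<alpha> * integral {t0..t} (\<lambda>s. s powr \<alpha> * (norm (a s))\<^sup>2) \<le>
        1 / t powr \<alpha> * (t powr \<alpha> * (M / t * A) - c + L * (M\<^sup>2 * t powr \<alpha> / t))"
      by (rule mult_left_mono) simp
    also have "\<dots> = (M * A + L * M\<^sup>2) * inverse t - c * t powr (- \<alpha>)"
      using t by (simp add: powr_minus field_simps)
    finally show ?case .
  qed
  show "\<forall>\<^sub>F t in at_top. 0 \<le> 1 / t powr \<alpha> * integral {t0..t} (\<lambda>s. s powr \<alpha> * (norm (a s))\<^sup>2)"
  proof (rule always_eventually, rule allI)
    fix t
    have "(\<lambda>s. s powr \<alpha> * (norm (a s))\<^sup>2) integrable_on {t0..t}"
      using t0_pos by (intro integrable_continuous_real continuous_intros continuous_on_subset[OF a_cont]) auto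
    then show "0 \<le> 1 / t powr \<alpha> * integral {t0..t} (\<lambda>s. s powr \<alpha> * (norm (a s))\<^sup>2)"
      by (intro mult_nonneg_nonneg integral_nonneg) auto
  qed
qed simp

section \<open>Boundedness and Lipschitz continuity of the acceleration\<close>

text \<open>Both other terms of the equation are bounded. The gradient is compared with its value at
  \<open>x t0\<close> and not at \<open>z\<close>, because \<open>L\<close> is a Lipschitz constant
  on the orbit only; two orbit points are at most \<open>2 * R\<close> apart.\<close>

lemma bounded_acceleration:
  assumes L: "L-lipschitz_on (x ` {t0..}) g" and "\<alpha> \<ge> 0"
    and R: "\<And>t. t \<ge> t0 \<Longrightarrow> norm (x t - z) \<le> R"
    and M: "\<And>t. t \<ge> t0 \<Longrightarrow> norm (v t) \<le> M"
  obtains A where "A \<ge> 0" "\<And>t. t \<ge> t0 \<Longrightarrow> norm (a t) \<le> A"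
proof -
  define A where "A = \<alpha> / t0 * M + (L * (2 * R) + norm (g (x t0)))"
  have A: "norm (a t) \<le> A" if t: "t \<ge> t0" for t
  proof -
    have "norm (a t) \<le> norm ((\<alpha> / t) *\<^sub>R v t) + norm (g (x t))"
      using norm_triangle_ineq4[of "- ((\<alpha> / t) *\<^sub>R v t)" "g (x t)"] by (simp add: a_eq[OF t])
    moreover have "norm ((\<alpha> / t) *\<^sub>R v t) \<le> \<alpha> / t0 * M"
      using M[OF t] t t0_pos \<open>\<alpha> \<ge> 0\<close> mult_mono[of "\<alpha> / t" "\<alpha> / t0" "norm (v t)" M]
      by (simp add: divide_left_mono)
    moreover have "norm (x t - x t0) \<le> 2 * R"
      using R[OF t] R[of t0] norm_triangle_ineq4[of "x t - z" "x t0 - z"] by simp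
    then have "norm (g (x t) - g (x t0)) \<le> L * (2 * R)"
      using lipschitz_onD[OF L, of "x t" "x t0"] t mult_left_mono[OF _ lipschitz_on_nonneg[OF L]]
      by (fastforce simp: dist_norm intro: order_trans)
    then have "norm (g (x t)) \<le> L * (2 * R) + norm (g (x t0))"
      using norm_triangle_sub[of "g (x t)" "g (x t0)"] by linarith
    ultimately show ?thesis unfolding A_def by linarith
  qed
  moreover have "A \<ge> 0" using A[of t0] norm_ge_zero[of "a t0"] by linarith
  ultimately show thesis using that by blast
qed

text \<open>The two parts of the equation are treated separately: the damping term has a bounded
  derivative, which gives the first two summands of the constant, while \<open>g\<close> along the
  trajectory is a composition of Lipschitz maps with constants \<open>L\<close> and
  \<open>M\<close>.\<close>

lemma lipschitz_acceleration:
  assumes L: "L-lipschitz_on (x ` {t0..}) g" and "\<alpha> \<ge> 0" "M \<ge> 0" "A \<ge> 0"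
    and M: "\<And>t. t \<ge> t0 \<Longrightarrow> norm (v t) \<le> M" and A: "\<And>t. t \<ge> t0 \<Longrightarrow> norm (a t) \<le> A"
  shows "(\<alpha> / t0 * A + \<alpha> / t0\<^sup>2 * M + L * M)-lipschitz_on {t0..} a"
proof -
  have "M-lipschitz_on {t0..} x"
    using x_deriv M \<open>M \<ge> 0\<close> by (intro bounded_vector_derivative_imp_lipschitz) auto
  then have "(L * M)-lipschitz_on {t0..} (\<lambda>t. g (x t))"
    using L by (rule lipschitz_on_compose2)
  moreover have "(\<alpha> / t0 * A + \<alpha> / t0\<^sup>2 * M)-lipschitz_on {t0..} (\<lambda>t. - (\<alpha> / t) *\<^sub>R v t)"
  proof (rule bounded_vector_derivative_imp_lipschitz)
    fix t assume "t \<in> {t0..}"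
    then have t: "t \<ge> t0" "t > 0" using t0_pos by auto
    have "((\<lambda>t. - (\<alpha> / t)) has_real_derivative \<alpha> / t\<^sup>2) (at t within {t0..})"
      using t by (auto intro!: derivative_eq_intros simp: power2_eq_square)
    then show "((\<lambda>t. - (\<alpha> / t) *\<^sub>R v t) has_vector_derivative
        (- (\<alpha> / t) *\<^sub>R a t + (\<alpha> / t\<^sup>2) *\<^sub>R v t)) (at t within {t0..})"
      by (rule has_vector_derivative_scaleR) (rule v_deriv[OF t(1)])
    have "norm ((\<alpha> / t) *\<^sub>R a t) \<le> \<alpha> / t0 * A"
      using A[OF t(1)] t t0_pos \<open>\<alpha> \<ge> 0\<close> mult_mono[of "\<alpha> / t" "\<alpha> / t0" "norm (a t)" A]
      by (simp add: divide_left_mono)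
    moreover have "norm ((\<alpha> / t\<^sup>2) *\<^sub>R v t) \<le> \<alpha> / t0\<^sup>2 * M"
      using M[OF t(1)] t t0_pos \<open>\<alpha> \<ge> 0\<close> mult_mono[of "\<alpha> / t\<^sup>2" "\<alpha> / t0\<^sup>2" "norm (v t)" M]
      by (simp add: divide_left_mono power_mono)
    ultimately show "norm (- (\<alpha> / t) *\<^sub>R a t + (\<alpha> / t\<^sup>2) *\<^sub>R v t) \<le> \<alpha> / t0 * A + \<alpha> / t0\<^sup>2 * M"
      using norm_triangle_ineq[of "- (\<alpha> / t) *\<^sub>R a t" "(\<alpha> / t\<^sup>2) *\<^sub>R v t"] by simp
  qed (use assms t0_pos in auto)
  ultimately have "(\<alpha> / t0 * A + \<alpha> / t0\<^sup>2 * M + L * M)-lipschitz_on {t0..}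
      (\<lambda>t. - (\<alpha> / t) *\<^sub>R v t - g (x t))"
    by (intro lipschitz_on_diff)
  then show ?thesis
    by (rule lipschitz_on_transform) (simp add: a_eq)
qed

end

section \<open>Choice of a minimizer and assembly of the estimates\<close>

theorem proposition2p17:
  fixes \<Phi> :: "'a::{real_inner, banach} \<Rightarrow> real"
    and grad\<Phi> :: "'a \<Rightarrow> 'a"
    and t0 \<alpha> :: real
    and x x' x'' :: "real \<Rightarrow> 'a"
  assumes "\<And>z. GDERIV \<Phi> z :> grad\<Phi> z"
    and "continuous_on UNIV grad\<Phi>"
    and "convex_on UNIV \<Phi>"
    and "argmin_set \<Phi> \<noteq> {}"
    and "lipschitz_on_bounded_sets grad\<Phi>"
    and "t0 > 0"
    and "\<alpha> > 3"
    and "solution_with_derivs t0 \<alpha> grad\<Phi> x x' x''"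
  shows "bounded (x'' ` {t0..}) \<and>
         (\<exists>L. L-lipschitz_on {t0..} x'') \<and>
         ((\<lambda>t. 1 / t powr \<alpha> * integral {t0..t} (\<lambda>s. s powr \<alpha> * (norm (x'' s))\<^sup>2)) \<longlongrightarrow> 0) at_top"
proof -
  interpret vanishing_damping \<Phi> grad\<Phi> t0 \<alpha> x x' x''
    using assms by unfold_locales auto
  obtain z where "\<And>y. \<Phi> z \<le> \<Phi> y" using assms(4) by (auto simp: argmin_set_def)
  then obtain M where M: "\<And>t. t \<ge> t0 \<Longrightarrow> norm (x t - z) \<le> M" "\<And>t. t \<ge> t0 \<Longrightarrow> norm (x' t) \<le> M / t"
    using bounded_trajectory assms(3,7) by metis
  have "M \<ge> 0" using M(1)[of t0] norm_ge_zero[of "x t0 - z"] by linarith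
  have M': "norm (x' t) \<le> M / t0" if "t \<ge> t0" for t
    using M(2)[OF that] divide_left_mono[OF that \<open>M \<ge> 0\<close>] that \<open>t0 > 0\<close> by force
  \<comment> \<open>Boundedness of the orbit turns the Lipschitz property on bounded sets into a
    single constant valid for all times.\<close>
  have "bounded (x ` {t0..})"
    using M(1) by (auto simp: bounded_def dist_norm norm_minus_commute intro!: exI[of _ z] exI[of _ M])
  then obtain L where L: "L-lipschitz_on (x ` {t0..}) grad\<Phi>"
    using assms(5) by (auto simp: lipschitz_on_bounded_sets_def)
  obtain A where A: "A \<ge> 0" "\<And>t. t \<ge> t0 \<Longrightarrow> norm (x'' t) \<le> A"
    using bounded_acceleration[OF L _ M(1) M'] \<open>\<alpha> > 3\<close> by auto
  have "bounded (x'' ` {t0..})"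
    using A(2) by (intro boundedI) auto
  moreover have "\<exists>C. C-lipschitz_on {t0..} x''"
    using lipschitz_acceleration[OF L _ _ A(1) M' A(2)] assms(6,7) \<open>M \<ge> 0\<close> by auto
  moreover have "((\<lambda>t. 1 / t powr \<alpha> * integral {t0..t} (\<lambda>s. s powr \<alpha> * (norm (x'' s))\<^sup>2)) \<longlongrightarrow> 0) at_top"
    using weighted_acceleration_tendsto_0[OF L _ M(2) A(2)] assms(7) by auto
  ultimately show ?thesis by blast
qed

end
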